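(* Let $N\ge3$ be an integer and $\hat\rho_1,\hat\rho_2,p_{\rm eq}\in[0,1]$. Let $q_{\rm eq}=\max\left(0,\min\left(1,-\frac{B_N(\hat\rho_2,p_{\rm eq})}{A_N(\hat\rho_2,p_{\rm eq})}\right)\right)$ and $\alpha_1=A_N(\hat\rho_1,p_{\rm eq})\,q_{\rm eq}+B_N(\hat\rho_1,p_{\rm eq})$. Consider player 1's utility $q_1\mapsto\mathcal U_1((q_1,q_{\rm eq},p_{\rm eq},\dots,p_{\rm eq}),\hat\rho_1)$ on $[0,1]$ (player 2 uses $q_{\rm eq}$ and the other $N-2$ players use $p_{\rm eq}$). Its set of maximizers (best responses of player 1) is $\{1\}$ if $\alpha_1>0$, $\{0\}$ if $\alpha_1<0$, and $[0,1]$ if $\alpha_1=0$. Moreover, the sign of $\alpha_1$ is determined as follows: (a) if $\hat\rho_2\ge\rho^{\uparrow}(p_{\rm eq},N)$, then $q_{\rm eq}=1$ and $\alpha_1$ is positive, zero or negative according to whether $\hat\rho_1$ is greater than, equal to or less than $\rho^{\uparrow}(p_{\rm eq},N)$; (b) if $\hat\rho_2\le\rho^{\downarrow}(p_{\rm eq},N)$, then $q_{\rm eq}=0$ and $\alpha_1$ is positive, zero or negative according to whether $\hat\rho_1$ is greater than, equal to or less than $\rho^{\downarrow}(p_{\rm eq},N)$; (c) if $\rho^{\downarrow}(p_{\rm eq},N)<\hat\rho_2<\rho^{\uparrow}(p_{\rm eq},N)$, then $q_{\rm eq}=-\frac{B_N(\hat\rho_2,p_{\rm eq})}{A_N(\hat\rho_2,p_{\rm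 eq})}\in(0,1)$ and $\alpha_1$ is positive, zero or negative according to whether $\hat\rho_1$ is greater than, equal to or less than $\hat\rho_2$.
   Context: Game: there are $N\ge3$ players. Each player $j$ bets $a_j\in\{0,1\}$ (1 = Heads, 0 = Tails) on an outcome $w\in\{0,1\}$. The payoff of player $i$ is $u_i(\vec a\mid w)=0$ if no $j$ has $a_j=w$, and otherwise $u_i(\vec a\mid w)=N\,\dfrac{\delta_{w,a_i}}{\sum_j\delta_{w,a_j}}-1$, with $\delta$ the Kronecker delta. A strategy $p_j\in[0,1]$ is the probability that player $j$ bets 1; bets are independent across players. Given a strategy profile $\vec p=(p_1,\dots,p_N)$ and a belief $r\in[0,1]$, $$\mathcal U_i(\vec p,r)=r\,\mathbb E_{\vec a}[u_i(\vec a\mid 1)]+(1-r)\,\mathbb E_{\vec a}[u_i(\vec a\mid 0)],$$ where under $\mathbb E_{\vec a}$ the $a_j$ are independent Bernoulli($p_j$). For $\rho\in[0,1]$ and $p\in(0,1)$ define $$A_N(\rho,p)=\frac{\rho\left(p^N(N(p-1)-2p+1)+(1-p)^N+p\left((N-2)(1-p)^N+2\right)-1\right)+p^N(-Np+N+2p-1)-p^2}{(N-1)(p-1)^2p^2},$$ $$B_N(\rho,p)=\frac{\rho\left(p\left(p^N+(1-p)^N-1\right)-N\left((1-p)^N+p-1\right)\right)}{(N-1)(p-1)^2p}+\frac{-p^N+N(p-1)+1}{(N-1)(p-1)^2},$$ with values at $p\in\{0,1\}$ given by the limits $A_N(\rho,0)=-\frac{N(N-3)}{2(N-1)}\rho-\frac1{N-1}$,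 $A_N(\rho,1)=\frac{N(N-3)}{2(N-1)}\rho-\frac N2+1$, $B_N(\rho,0)=N\rho-1$, $B_N(\rho,1)=\frac{N(N+1)}{2(N-1)}\rho-\frac N2$. Thresholds: for $p\in(0,1)$, $$\rho^{\downarrow}(p,N)=-\frac{p\left(-p^N+N(p-1)+1\right)}{p\left(p^N+(1-p)^N-1\right)-N\left((1-p)^N+p-1\right)},\qquad \rho^{\uparrow}(p,N)=\frac{1}{1-\frac{(p-1)\left((1-p)^N+Np-1\right)}{Np^2-p^N(N+p-1)}},$$ with values at the endpoints given by the limits $\rho^{\downarrow}(0,N)=\frac1N$, $\rho^{\downarrow}(1,N)=\frac{N-1}{N+1}$, $\rho^{\uparrow}(0,N)=\frac2{N+1}$, $\rho^{\uparrow}(1,N)=1-\frac1N$. *)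

theory Defs
  imports "HOL-Probability.Probability"
begin

text \<open>
  The players are \<open>1, \<dots>, N\<close>. Bets and outcomes are booleans, with \<open>True\<close> for
  \<open>1\<close> (Heads) and \<open>False\<close> for \<open>0\<close> (Tails).
\<close>

definition payoff :: "nat \<Rightarrow> nat \<Rightarrow> (nat \<Rightarrow> bool) \<Rightarrow> bool \<Rightarrow> real" where
  "payoff N i a w =
     (if \<exists>j\<in>{1..N}. a j = w
      then real N * (of_bool (a i = w) / (\<Sum>j\<in>{1..N}. of_bool (a j = w))) - 1
      else 0)"

text \<open>
  Under \<open>bets N p\<close> the bets \<open>a j\<close> with \<open>j \<in> {1..N}\<close> are independent
  Bernoulli variables with parameters \<open>p j\<close>; outside \<open>{1..N}\<close> the function
  \<open>a\<close> has the irrelevant value \<open>False\<close>.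
  The parameters are meant to lie in \<open>[0,1]\<close>, since \<open>bernoulli_pmf\<close> clamps them.
\<close>

definition bets :: "nat \<Rightarrow> (nat \<Rightarrow> real) \<Rightarrow> (nat \<Rightarrow> bool) pmf" where
  "bets N p = Pi_pmf {1..N} False (\<lambda>j. bernoulli_pmf (p j))"

definition utility :: "nat \<Rightarrow> nat \<Rightarrow> (nat \<Rightarrow> real) \<Rightarrow> real \<Rightarrow> real" where
  "utility N i p r =
     r * measure_pmf.expectation (bets N p) (\<lambda>a. payoff N i a True)
     + (1 - r) * measure_pmf.expectation (bets N p) (\<lambda>a. payoff N i a False)"

text \<open>The strategy profile \<open>(x, y, p, \<dots>, p)\<close>.\<close>

definition profile :: "real \<Rightarrow> real \<Rightarrow> real \<Rightarrow> nat \<Rightarrow> real" where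
  "profile x y p = (\<lambda>j. if j = 1 then x else if j = 2 then y else p)"

text \<open>
  In the following definitions the values at \<open>p = 0\<close> and \<open>p = 1\<close> are the limits of
  the generic formula, in which the denominator vanishes at these points.
\<close>

definition coeff_A :: "nat \<Rightarrow> real \<Rightarrow> real \<Rightarrow> real" where
  "coeff_A N \<rho> p =
     (if p = 0 then
        - (real N * (real N - 3) / (2 * (real N - 1))) * \<rho> - 1 / (real N - 1)
      else if p = 1 then
        real N * (real N - 3) / (2 * (real N - 1)) * \<rho> - real N / 2 + 1
      else
        (\<rho> * (p ^ N * (real N * (p - 1) - 2 * p + 1) + (1 - p) ^ N
              + p * ((real N - 2) * (1 - p) ^ N + 2) - 1)
          + p ^ N * (- p * real N + real N + 2 * p - 1) - p ^ 2)
        / ((real N - 1) * (p - 1) ^ 2 * p ^ 2))"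

definition coeff_B :: "nat \<Rightarrow> real \<Rightarrow> real \<Rightarrow> real" where
  "coeff_B N \<rho> p =
     (if p = 0 then real N * \<rho> - 1
      else if p = 1 then
        real N * (real N + 1) / (2 * (real N - 1)) * \<rho> - real N / 2
      else
        \<rho> * (p * (p ^ N + (1 - p) ^ N - 1) - real N * ((1 - p) ^ N + p - 1))
          / ((real N - 1) * (p - 1) ^ 2 * p)
        + (- (p ^ N) + real N * (p - 1) + 1) / ((real N - 1) * (p - 1) ^ 2))"

definition rho_down :: "real \<Rightarrow> nat \<Rightarrow> real" where
  "rho_down p N =
     (if p = 0 then 1 / real N
      else if p = 1 then (real N - 1) / (real N + 1)
      else
        - (p * (- (p ^ N) + real N * (p - 1) + 1)
           / (p * (p ^ N + (1 - p) ^ N - 1) - real N * ((1 - p) ^ N + p - 1))))"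

definition rho_up :: "real \<Rightarrow> nat \<Rightarrow> real" where
  "rho_up p N =
     (if p = 0 then 2 / (real N + 1)
      else if p = 1 then 1 - 1 / real N
      else
        1 / (1 - (p - 1) * ((1 - p) ^ N + real N * p - 1)
                 / (real N * p ^ 2 - p ^ N * (real N + p - 1))))"

end

theory Submission
  imports Defs
begin

text \<open>
  Player 1's utility is affine in \<open>x\<close>, so only the sign of its slope matters. The slope is
  \<open>q * (\<rho> * G1 - (1 - \<rho>) * H1) + (1 - q) * (\<rho> * G0 - (1 - \<rho>) * H0)\<close>, where \<open>G\<close> and \<open>H\<close> are the
  gains of betting on Heads (resp. Tails) if that is the outcome, and the index is the bet of
  player 2. The coefficients are \<open>B = \<rho> * G0 - (1 - \<rho>) * H0\<close> and
  \<open>A + B = \<rho> * G1 - (1 - \<rho>) * H1\<close>, and the thresholds are the zeros of \<open>B\<close> and of \<open>A + B\<close> in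
  \<open>\<rho>\<close>, namely \<open>H0 / (G0 + H0)\<close> and \<open>H1 / (G1 + H1)\<close>. Sharing the winning side
  with player 2 costs something, \<open>G1 < G0\<close> and \<open>H0 < H1\<close>, so that \<open>A < 0\<close> and the thresholds are
  strictly ordered.
\<close>

section \<open>Means under the binomial distribution\<close>

text \<open>The expectation of \<open>f\<close> under the binomial distribution with parameters
  \<open>m\<close> and \<open>p\<close>, written as a finite sum so that the identities below make
  sense for every real \<open>p\<close>. Only positivity and the link to \<open>pmf\<close>
  expectations need \<open>p\<close> in the unit interval.\<close>

definition binomial_mean :: "nat \<Rightarrow> real \<Rightarrow> (nat \<Rightarrow> real) \<Rightarrow> real" where
  "binomial_mean m p f = (\<Sum>k\<le>m. real (m choose k) * p ^ k * (1 - p) ^ (m - k) * f k)"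

lemma binomial_mean_diff:
  "binomial_mean m p (\<lambda>k. f k - g k) = binomial_mean m p f - binomial_mean m p g"
  by (simp add: binomial_mean_def algebra_simps sum_subtractf)

lemma binomial_mean_cmult:
  "binomial_mean m p (\<lambda>k. c * f k) = c * binomial_mean m p f"
  by (simp add: binomial_mean_def sum_distrib_left mult_ac)

lemma binomial_mean_const: "binomial_mean m p (\<lambda>_. c) = c"
proof -
  have "(\<Sum>k\<le>m. real (m choose k) * p ^ k * (1 - p) ^ (m - k)) = 1"
    using binomial_ring[of p "1 - p" m] by simp
  then show ?thesis
    by (simp add: binomial_mean_def flip: sum_distrib_right)
qed

lemma binomial_mean_zero: "binomial_mean m 0 f = f 0"
proof -
  have "binomial_mean m 0 f = (\<Sum>k\<le>m. if k = 0 then f 0 else 0)"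
    unfolding binomial_mean_def by (intro sum.cong) auto
  then show ?thesis by simp
qed

text \<open>Exchanging success and failure. This turns counts of Heads into counts of Tails.\<close>

lemma binomial_mean_reflect:
  "binomial_mean m (1 - p) f = binomial_mean m p (\<lambda>k. f (m - k))"
  unfolding binomial_mean_def
  by (rule sum.reindex_bij_witness[where i = "\<lambda>k. m - k" and j = "\<lambda>k. m - k"])
     (auto simp: binomial_symmetric[symmetric] mult_ac)

lemma binomial_mean_at_0: "binomial_mean m p (\<lambda>k. of_bool (k = 0)) = (1 - p) ^ m"
proof -
  have "binomial_mean m p (\<lambda>k. of_bool (k = 0)) = (\<Sum>k\<le>m. if k = 0 then (1 - p) ^ m else 0)"
    unfolding binomial_mean_def by (intro sum.cong) auto
  then show ?thesis by simp
qed

text \<open>Single weights may vanish at \<open>p = 0\<close> or \<open>p = 1\<close>, but since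
  they are nonnegative and sum to 1, one of them is positive.\<close>

lemma binomial_mean_pos:
  assumes "p \<in> {0..1}" and f: "\<And>k. k \<le> m \<Longrightarrow> f k > 0"
  shows "binomial_mean m p f > 0"
proof -
  let ?w = "\<lambda>k. real (m choose k) * p ^ k * (1 - p) ^ (m - k)"
  have w: "?w k \<ge> 0" for k using assms(1) by simp
  have "sum ?w {..m} = 1"
    using binomial_ring[of p "1 - p" m] by simp
  then obtain k where k: "k \<le> m" "?w k \<noteq> 0"
    by (metis (no_types, lifting) atMost_iff sum.neutral zero_neq_one)
  have "?w k * f k > 0"
    using k w[of k] f[of k] by (metis less_eq_real_def mult_pos_pos)
  moreover have "\<And>j. j \<le> m \<Longrightarrow> ?w j * f j \<ge> 0"
    using w f by (metis less_eq_real_def mult_nonneg_nonneg)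
  ultimately show ?thesis
    unfolding binomial_mean_def using k(1) by (intro sum_pos2[of _ k]) auto
qed

text \<open>Absorption, \<open>(m + 1) * (m choose k) = (m + 1 choose k + 1) * (k + 1)\<close>,
  turns the left side into the binomial expansion of order \<open>m + 1\<close> without its term of
  index 0. The multiplied form avoids dividing by \<open>p\<close>.\<close>

lemma binomial_mean_inverse_Suc:
  "real (m + 1) * p * binomial_mean m p (\<lambda>k. 1 / (real k + 1)) = 1 - (1 - p) ^ (m + 1)"
proof -
  have *: "real (m + 1) * p * (real (m choose k) * p ^ k * (1 - p) ^ (m - k) * (1 / (real k + 1)))
      = real (Suc m choose Suc k) * p ^ Suc k * (1 - p) ^ (Suc m - Suc k)" for k
  proof -
    have "real (Suc m) * real (m choose k) = real (Suc m choose Suc k) * real (Suc k)"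
      using Suc_times_binomial_eq[of m k] by (metis of_nat_mult)
    then have "real (Suc m) * real (m choose k) / real (Suc k) = real (Suc m choose Suc k)"
      by simp
    then have "real (Suc m choose Suc k) * p ^ Suc k * (1 - p) ^ (Suc m - Suc k)
        = (real (Suc m) * real (m choose k) / real (Suc k)) * p ^ Suc k * (1 - p) ^ (Suc m - Suc k)"
      by (simp only:)
    then show ?thesis
      by (simp add: mult_ac add_ac del: binomial_Suc_Suc)
  qed
  have "1 = (\<Sum>k\<le>Suc m. real (Suc m choose k) * p ^ k * (1 - p) ^ (Suc m - k))"
    using binomial_ring[of p "1 - p" "Suc m"] by simp
  also have "\<dots> = (1 - p) ^ Suc m
      + (\<Sum>k\<le>m. real (Suc m choose Suc k) * p ^ Suc k * (1 - p) ^ (Suc m - Suc k))"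
    by (subst sum.atMost_Suc_shift) simp
  finally show ?thesis
    unfolding binomial_mean_def sum_distrib_left * by simp
qed

text \<open>Absorbing twice evaluates the mean of \<open>1 / ((k + 1) * (k + 2))\<close>, where the
  terms of index 0 and 1 of the expansion of order \<open>m + 2\<close> are missing. Partial
  fractions then combine it with the previous lemma.\<close>

lemma binomial_mean_inverse_Suc_Suc:
  "real (m + 1) * real (m + 2) * p ^ 2 * binomial_mean m p (\<lambda>k. 1 / (real k + 2))
     = real (m + 2) * p - 1 + (1 - p) ^ (m + 2)"
proof -
  have *: "real (m + 1) * real (m + 2) * p ^ 2 *
        (real (m choose k) * p ^ k * (1 - p) ^ (m - k) * (1 / ((real k + 1) * (real k + 2))))
      = real (Suc (Suc m) choose Suc (Suc k)) * p ^ Suc (Suc k)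
        * (1 - p) ^ (Suc (Suc m) - Suc (Suc k))" for k
  proof -
    have 1: "real (Suc m) * real (m choose k) = real (Suc m choose Suc k) * real (Suc k)"
      using Suc_times_binomial_eq[of m k] by (metis of_nat_mult)
    have 2: "real (Suc (Suc m)) * real (Suc m choose Suc k)
        = real (Suc (Suc m) choose Suc (Suc k)) * real (Suc (Suc k))"
      using Suc_times_binomial_eq[of "Suc m" "Suc k"] by (metis of_nat_mult)
    have "real (m + 1) * real (m + 2) * real (m choose k)
        = real (Suc (Suc m) choose Suc (Suc k)) * ((real k + 1) * (real k + 2))"
    proof -
      have "real (m + 1) * real (m + 2) * real (m choose k)
          = real (Suc (Suc m)) * (real (Suc m) * real (m choose k))" by simp
      also have "\<dots> = real (Suc (Suc m)) * real (Suc m choose Suc k) * real (Suc k)"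
        unfolding 1 by (simp only: mult_ac)
      also have "\<dots> = real (Suc (Suc m) choose Suc (Suc k)) * real (Suc (Suc k)) * real (Suc k)"
        unfolding 2 ..
      finally show ?thesis
        by (simp only: of_nat_Suc mult_ac add_ac) simp
    qed
    then have "real (m + 1) * real (m + 2) * real (m choose k) * (1 / ((real k + 1) * (real k + 2)))
        = real (Suc (Suc m) choose Suc (Suc k))"
      by (simp add: divide_simps del: binomial_Suc_Suc)
    then show ?thesis
      by (subst (asm) eq_commute) (simp only: power2_eq_square power_Suc diff_Suc_Suc mult_ac)
  qed
  have "1 = (\<Sum>k\<le>Suc (Suc m). real (Suc (Suc m) choose k) * p ^ k * (1 - p) ^ (Suc (Suc m) - k))"
    using binomial_ring[of p "1 - p" "Suc (Suc m)"] by simp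
  also have "\<dots> = (1 - p) ^ (m + 2) + real (m + 2) * p * (1 - p) ^ (m + 1)
      + (\<Sum>k\<le>m. real (Suc (Suc m) choose Suc (Suc k)) * p ^ Suc (Suc k)
          * (1 - p) ^ (Suc (Suc m) - Suc (Suc k)))"
    by (subst sum.atMost_Suc_shift, subst sum.atMost_Suc_shift)
       (simp del: binomial_Suc_Suc)
  also have "(\<Sum>k\<le>m. real (Suc (Suc m) choose Suc (Suc k)) * p ^ Suc (Suc k)
          * (1 - p) ^ (Suc (Suc m) - Suc (Suc k)))
      = real (m + 1) * real (m + 2) * p ^ 2
        * binomial_mean m p (\<lambda>k. 1 / ((real k + 1) * (real k + 2)))"
    unfolding binomial_mean_def sum_distrib_left * ..
  finally have "real (m + 1) * real (m + 2) * p ^ 2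
        * binomial_mean m p (\<lambda>k. 1 / ((real k + 1) * (real k + 2)))
      = 1 - (1 - p) ^ (m + 2) - real (m + 2) * p * (1 - p) ^ (m + 1)" by linarith
  moreover have "binomial_mean m p (\<lambda>k. 1 / (real k + 2))
      = binomial_mean m p (\<lambda>k. 1 / (real k + 1))
        - binomial_mean m p (\<lambda>k. 1 / ((real k + 1) * (real k + 2)))"
  proof -
    have "1 / (real k + 2) = 1 / (real k + 1) - 1 / ((real k + 1) * (real k + 2))" for k
      by (simp add: divide_simps)
    then show ?thesis
      by (simp add: binomial_mean_diff)
  qed
  moreover have "real (m + 1) * real (m + 2) * p ^ 2 * binomial_mean m p (\<lambda>k. 1 / (real k + 1))
      = real (m + 2) * p * (1 - (1 - p) ^ (m + 1))"
    unfolding binomial_mean_inverse_Suc[symmetric] by (simp add: power2_eq_square mult_ac)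
  ultimately show ?thesis
    by (simp only: right_diff_distrib)
qed

text \<open>
  With \<open>p\<close> the probability that each of the \<open>N - 2\<close> other players bets on the outcome, the gain of
  player 1 from betting on it rather than against it: \<open>lone_gain\<close> if player 2 bets against it,
  \<open>shared_gain\<close> if player 2 bets on it. The subtracted power is due to the payoff being \<open>0\<close>, not
  \<open>-1\<close>, when nobody bets on the outcome.
\<close>

definition lone_gain :: "nat \<Rightarrow> real \<Rightarrow> real" where
  "lone_gain N p = real N * binomial_mean (N - 2) p (\<lambda>k. 1 / (real k + 1)) - (1 - p) ^ (N - 2)"

definition shared_gain :: "nat \<Rightarrow> real \<Rightarrow> real" where
  "shared_gain N p = real N * binomial_mean (N - 2) p (\<lambda>k. 1 / (real k + 2))"

section \<open>Comparison, closed forms and endpoint values of the two gains\<close>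

lemma shared_gain_pos:
  assumes "N \<ge> 1" "p \<in> {0..1}"
  shows "shared_gain N p > 0"
  unfolding shared_gain_def using assms
  by (intro mult_pos_pos binomial_mean_pos) auto

text \<open>The inequality holds term by term. The critical term is \<open>k = 0\<close>, where the
  difference is \<open>N / 2 - 1\<close>; it is positive because \<open>N\<close> exceeds 2.\<close>

lemma shared_gain_less_lone_gain:
  assumes "N \<ge> 3" "p \<in> {0..1}"
  shows "shared_gain N p < lone_gain N p"
proof -
  have "0 < binomial_mean (N - 2) p
      (\<lambda>k. real N * (1 / (real k + 1)) - of_bool (k = 0) - real N * (1 / (real k + 2)))"
    using assms by (intro binomial_mean_pos) (auto simp: divide_simps)
  also have "\<dots> = lone_gain N p - shared_gain N p"
    by (simp only: binomial_mean_diff binomial_mean_cmult binomial_mean_at_0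
        lone_gain_def shared_gain_def)
  finally show ?thesis by simp
qed

lemma lone_gain_closed_form:
  assumes "N \<ge> 2"
  shows "(real N - 1) * p * (1 - p) ^ 2 * lone_gain N p
    = real N * (1 - p) * ((1 - p) - (1 - p) ^ N) - (real N - 1) * p * (1 - p) ^ N"
proof -
  obtain m where m: "N = m + 2" using assms by (metis add.commute le_Suc_ex)
  \<comment> \<open>The factor \<open>(1 - p) ^ 2\<close> raises the exponent \<open>N - 2\<close>
    in the gain to the exponent \<open>N\<close> of the formulas for the coefficients.\<close>
  define b S T where "b = binomial_mean m p (\<lambda>k. 1 / (real k + 1))"
    and "S = (1 - p) ^ m" and "T = (1 - p) ^ N"
  have "(real N - 1) * p * b = 1 - (1 - p) * S"
    using binomial_mean_inverse_Suc[of m p] by (simp add: m b_def S_def add_ac)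
  moreover have "lone_gain N p = real N * b - S"
    by (simp add: lone_gain_def m b_def S_def)
  moreover have "T = (1 - p) ^ 2 * S"
    by (simp add: m S_def T_def power2_eq_square)
  ultimately show ?thesis
    unfolding T_def[symmetric] by algebra
qed

lemma shared_gain_closed_form:
  assumes "N \<ge> 2"
  shows "(real N - 1) * p ^ 2 * shared_gain N p = real N * p - 1 + (1 - p) ^ N"
proof -
  obtain m where m: "N = m + 2" using assms by (metis add.commute le_Suc_ex)
  then show ?thesis
    using binomial_mean_inverse_Suc_Suc[of m p] by (simp add: shared_gain_def mult_ac add_ac)
qed

lemma lone_gain_0: "N \<ge> 2 \<Longrightarrow> lone_gain N 0 = real N - 1"
  by (simp add: lone_gain_def binomial_mean_zero)

lemma shared_gain_0: "shared_gain N 0 = real N / 2"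
  by (simp add: shared_gain_def binomial_mean_zero)

text \<open>At \<open>p = 1\<close> the closed form reads \<open>0 = 0\<close>, so the identity for
  the mean is used directly.\<close>

lemma lone_gain_1: "N \<ge> 3 \<Longrightarrow> lone_gain N 1 = real N / (real N - 1)"
  using binomial_mean_inverse_Suc[of "N - 2" 1]
  by (simp add: lone_gain_def field_simps of_nat_diff)

lemma shared_gain_1: "N \<ge> 2 \<Longrightarrow> shared_gain N 1 = 1"
  using shared_gain_closed_form[of N 1] by (simp add: power_0_left)

section \<open>Coefficients and thresholds in terms of the gains\<close>

text \<open>At the endpoints the prescribed limits match the endpoint values of the gains. In
  between, both sides are multiplied by the common denominator \<open>c\<close> and the closed forms
  are inserted.\<close>

lemma coeff_B_eq:
  assumes "N \<ge> 3"
  shows "coeff_B N \<rho> p = \<rho> * lone_gain N p - (1 - \<rho>) * shared_gain N (1 - p)"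
proof -
  have N: "real N - 1 > 0" using assms by simp
  consider "p = 0" | "p = 1" | "p \<noteq> 0" "p \<noteq> 1" by blast
  then show ?thesis
  proof cases
    case 1
    then show ?thesis
      using assms by (simp add: coeff_B_def lone_gain_0 shared_gain_1 algebra_simps)
  next
    case 2
    then show ?thesis
      using assms N by (simp add: coeff_B_def lone_gain_1 shared_gain_0 field_simps)
  next
    case 3
    \<comment> \<open>With the two powers as opaque variables, what remains is a polynomial identity
      within reach of \<open>algebra\<close>.\<close>
    define P S where "P = p ^ N" and "S = (1 - p) ^ N"
    have lone: "(real N - 1) * p * (1 - p) ^ 2 * lone_gain N p
        = real N * (1 - p) * ((1 - p) - S) - (real N - 1) * p * S"
      using lone_gain_closed_form[of N p] assms by (simp add: S_def)
    have shared: "(real N - 1) * (1 - p) ^ 2 * shared_gain N (1 - p) = real N * (1 - p) - 1 + P"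
      using shared_gain_closed_form[of N "1 - p"] assms by (simp add: P_def)
    define c where "c = (real N - 1) * (p - 1) ^ 2 * p"
    have c: "c \<noteq> 0" using 3 N by (simp add: c_def)
    have "coeff_B N \<rho> p
        = (\<rho> * (p * (p ^ N + (1 - p) ^ N - 1) - real N * ((1 - p) ^ N + p - 1))) / c
          + (p * (- (p ^ N) + real N * (p - 1) + 1)) / c"
      using 3 by (simp add: coeff_B_def c_def)
    then have "c * coeff_B N \<rho> p
        = \<rho> * (p * (p ^ N + (1 - p) ^ N - 1) - real N * ((1 - p) ^ N + p - 1))
          + p * (- (p ^ N) + real N * (p - 1) + 1)"
      using c by (simp only: distrib_left[of c] times_divide_eq_right nonzero_mult_div_cancel_left
          not_False_eq_True)
    also have "\<dots> = c * (\<rho> * lone_gain N p - (1 - \<rho>) * shared_gain N (1 - p))"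
      using lone shared unfolding c_def P_def[symmetric] S_def[symmetric] by algebra
    finally show ?thesis using c by simp
  qed
qed

text \<open>The sum is treated rather than \<open>coeff_A\<close> alone because it is the slope when
  player 2 surely bets on Heads, which has the same shape as \<open>coeff_B\<close> with the two
  kinds of gain exchanged.\<close>

lemma coeff_A_plus_coeff_B_eq:
  assumes "N \<ge> 3"
  shows "coeff_A N \<rho> p + coeff_B N \<rho> p = \<rho> * shared_gain N p - (1 - \<rho>) * lone_gain N (1 - p)"
proof -
  have N: "real N - 1 > 0" using assms by simp
  consider "p = 0" | "p = 1" | "p \<noteq> 0" "p \<noteq> 1" by blast
  then show ?thesis
  proof cases
    case 1
    define k where "k = real N - 1"
    have "real N = k + 1" "k > 0" using N by (simp_all add: k_def)
    with 1 show ?thesis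
      using assms by (simp add: coeff_A_def coeff_B_def lone_gain_1 shared_gain_0 field_simps)
  next
    case 2
    define k where "k = real N - 1"
    have "real N = k + 1" "k > 0" using N by (simp_all add: k_def)
    with 2 show ?thesis
      using assms by (simp add: coeff_A_def coeff_B_def lone_gain_0 shared_gain_1 field_simps)
  next
    case 3
    define P S where "P = p ^ N" and "S = (1 - p) ^ N"
    have lone: "(real N - 1) * (1 - p) * p ^ 2 * lone_gain N (1 - p)
        = real N * p * (p - P) - (real N - 1) * (1 - p) * P"
      using lone_gain_closed_form[of N "1 - p"] assms by (simp add: P_def)
    have shared: "(real N - 1) * p ^ 2 * shared_gain N p = real N * p - 1 + S"
      using shared_gain_closed_form[of N p] assms by (simp add: S_def)
    define c where "c = (real N - 1) * (p - 1) ^ 2 * p ^ 2"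
    have c: "c \<noteq> 0" using 3 N by (simp add: c_def)
    \<comment> \<open>The extra factor \<open>p\<close> brings \<open>coeff_B\<close> over the
      denominator of \<open>coeff_A\<close>.\<close>
    have "coeff_B N \<rho> p
        = (p * (\<rho> * (p * (p ^ N + (1 - p) ^ N - 1) - real N * ((1 - p) ^ N + p - 1)))) / c
          + (p ^ 2 * (- (p ^ N) + real N * (p - 1) + 1)) / c"
      using 3 by (simp add: coeff_B_def c_def power2_eq_square[of p])
    then have "c * coeff_B N \<rho> p
        = p * (\<rho> * (p * (p ^ N + (1 - p) ^ N - 1) - real N * ((1 - p) ^ N + p - 1)))
          + p ^ 2 * (- (p ^ N) + real N * (p - 1) + 1)"
      using c by (simp only: distrib_left[of c] times_divide_eq_right nonzero_mult_div_cancel_left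
          not_False_eq_True)
    moreover have "c * coeff_A N \<rho> p =
        \<rho> * (p ^ N * (real N * (p - 1) - 2 * p + 1) + (1 - p) ^ N
              + p * ((real N - 2) * (1 - p) ^ N + 2) - 1)
          + p ^ N * (- p * real N + real N + 2 * p - 1) - p ^ 2"
      using 3 c by (simp add: coeff_A_def c_def)
    ultimately have "c * (coeff_A N \<rho> p + coeff_B N \<rho> p)
        = c * (\<rho> * shared_gain N p - (1 - \<rho>) * lone_gain N (1 - p))"
      using lone shared unfolding c_def P_def[symmetric] S_def[symmetric] by algebra
    then show ?thesis using c by simp
  qed
qed

text \<open>Numerator and denominator of the defining fraction are the gains scaled by the same
  nonzero \<open>c\<close>, which cancels.\<close>

lemma rho_down_eq:
  assumes "N \<ge> 3"
  shows "rho_down p N = shared_gain N (1 - p) / (lone_gain N p + shared_gain N (1 - p))"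
proof -
  have N: "real N - 1 > 0" using assms by simp
  consider "p = 0" | "p = 1" | "p \<noteq> 0" "p \<noteq> 1" by blast
  then show ?thesis
  proof cases
    case 1
    then show ?thesis
      using assms by (simp add: rho_down_def lone_gain_0 shared_gain_1)
  next
    case 2
    have "real N / (real N - 1) + real N / 2 > 0"
      using N assms by (intro add_pos_pos divide_pos_pos) auto
    with 2 show ?thesis
      using assms N by (simp add: rho_down_def lone_gain_1 shared_gain_0 field_simps)
  next
    case 3
    define P S where "P = p ^ N" and "S = (1 - p) ^ N"
    have lone: "(real N - 1) * p * (1 - p) ^ 2 * lone_gain N p
        = real N * (1 - p) * ((1 - p) - S) - (real N - 1) * p * S"
      using lone_gain_closed_form[of N p] assms by (simp add: S_def)
    have shared: "(real N - 1) * (1 - p) ^ 2 * shared_gain N (1 - p) = real N * (1 - p) - 1 + P"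
      using shared_gain_closed_form[of N "1 - p"] assms by (simp add: P_def)
    define c where "c = (real N - 1) * p * (1 - p) ^ 2"
    have c: "c \<noteq> 0" using 3 N by (simp add: c_def)
    have "c * shared_gain N (1 - p) = - (p * (- (p ^ N) + real N * (p - 1) + 1))"
      using shared unfolding c_def P_def[symmetric] S_def[symmetric] by algebra
    moreover have "c * (lone_gain N p + shared_gain N (1 - p))
        = p * (p ^ N + (1 - p) ^ N - 1) - real N * ((1 - p) ^ N + p - 1)"
      using lone shared unfolding c_def P_def[symmetric] S_def[symmetric] by algebra
    ultimately have "rho_down p N
        = (c * shared_gain N (1 - p)) / (c * (lone_gain N p + shared_gain N (1 - p)))"
      using 3 by (simp add: rho_down_def)
    then show ?thesis using c by simp
  qed
qed

text \<open>The nested fraction \<open>1 / (1 - X / Y)\<close> equals \<open>Y / (Y - X)\<close>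
  once \<open>Y\<close> is nonzero. This follows from the positivity of the gain, hence the range
  assumed for \<open>p\<close>.\<close>

lemma rho_up_eq:
  assumes "N \<ge> 3" and "p \<in> {0..1}"
  shows "rho_up p N = lone_gain N (1 - p) / (shared_gain N p + lone_gain N (1 - p))"
proof -
  have N: "real N - 1 > 0" using assms by simp
  consider "p = 0" | "p = 1" | "p \<noteq> 0" "p \<noteq> 1" by blast
  then show ?thesis
  proof cases
    case 1
    define k where "k = real N - 1"
    have k: "real N = k + 1" "k > 0" using N by (simp_all add: k_def)
    \<comment> \<open>This is the value of \<open>lone_gain N 1\<close>; it factors out of the
      denominator.\<close>
    define a where "a = (k + 1) / k"
    have a: "a \<noteq> 0" "(k + 1) / 2 + a = a * ((k + 2) / 2)"
      using k by (simp_all add: a_def field_simps)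
    have "rho_up p N = 2 / (k + 2)"
      using 1 k by (simp add: rho_up_def)
    also have "\<dots> = a / ((k + 1) / 2 + a)"
      unfolding a(2) using a(1) by simp
    finally show ?thesis
      using 1 k assms by (simp add: lone_gain_1 shared_gain_0 a_def)
  next
    case 2
    then show ?thesis
      using assms by (simp add: rho_up_def lone_gain_0 shared_gain_1 field_simps)
  next
    case 3
    define P S where "P = p ^ N" and "S = (1 - p) ^ N"
    have lone: "(real N - 1) * (1 - p) * p ^ 2 * lone_gain N (1 - p)
        = real N * p * (p - P) - (real N - 1) * (1 - p) * P"
      using lone_gain_closed_form[of N "1 - p"] assms by (simp add: P_def)
    have shared: "(real N - 1) * p ^ 2 * shared_gain N p = real N * p - 1 + S"
      using shared_gain_closed_form[of N p] assms by (simp add: S_def)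
    define c where "c = (real N - 1) * (1 - p) * p ^ 2"
    have c: "c \<noteq> 0" using 3 N by (simp add: c_def)
    define X Y where "X = (p - 1) * ((1 - p) ^ N + real N * p - 1)"
      and "Y = real N * p ^ 2 - p ^ N * (real N + p - 1)"
    have X: "c * shared_gain N p = - X"
      using shared unfolding X_def c_def S_def[symmetric] by algebra
    have Y: "c * lone_gain N (1 - p) = Y"
      using lone unfolding Y_def c_def P_def[symmetric] by algebra
    have "lone_gain N (1 - p) > 0"
      using shared_gain_less_lone_gain[of N "1 - p"] shared_gain_pos[of N "1 - p"] assms by auto
    with c Y have "Y \<noteq> 0" by auto
    have "rho_up p N = 1 / (1 - X / Y)"
      using 3 by (simp add: rho_up_def X_def Y_def)
    also have "\<dots> = Y / (- X + Y)" using \<open>Y \<noteq> 0\<close> by (simp add: divide_simps)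
    also have "\<dots> = (c * lone_gain N (1 - p)) / (c * (shared_gain N p + lone_gain N (1 - p)))"
      by (simp add: X Y distrib_left)
    finally show ?thesis using c by simp
  qed
qed

section \<open>Expected payoffs and the slope of the utility\<close>

text \<open>Conditioning on the bet of \<open>x\<close>. The finite support of the remaining product
  lets the expectation of the bind be expanded as a sum.\<close>

lemma expectation_Pi_bernoulli_insert:
  fixes h :: "('a \<Rightarrow> bool) \<Rightarrow> real"
  assumes "finite A" "x \<notin> A" "p x \<in> {0..1}"
  shows "measure_pmf.expectation (Pi_pmf (insert x A) d (\<lambda>j. bernoulli_pmf (p j))) h
    = p x * measure_pmf.expectation (Pi_pmf A d (\<lambda>j. bernoulli_pmf (p j))) (\<lambda>f. h (f(x := True)))
    + (1 - p x) * measure_pmf.expectation (Pi_pmf A d (\<lambda>j. bernoulli_pmf (p j)))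
        (\<lambda>f. h (f(x := False)))"
proof -
  let ?P = "Pi_pmf A d (\<lambda>j. bernoulli_pmf (p j))"
  have "finite (set_pmf ?P)"
    using assms(1) by (auto simp: set_Pi_pmf intro!: finite_PiE_dflt)
  then have "measure_pmf.expectation (bernoulli_pmf (p x) \<bind> (\<lambda>y. map_pmf (\<lambda>f. f(x := y)) ?P)) h
      = (\<Sum>y\<in>UNIV. pmf (bernoulli_pmf (p x)) y *\<^sub>R
          measure_pmf.expectation (map_pmf (\<lambda>f. f(x := y)) ?P) h)"
    by (intro pmf_expectation_bind) auto
  then show ?thesis
    using assms by (simp add: Pi_pmf_insert' map_pmf_def[symmetric] UNIV_bool)
qed

lemma expectation_Pi_bernoulli_card:
  fixes g :: "nat \<Rightarrow> real"
  assumes "finite A" "p \<in> {0..1}"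
  shows "measure_pmf.expectation (Pi_pmf A d (\<lambda>_. bernoulli_pmf p)) (\<lambda>f. g (card {x\<in>A. f x}))
    = binomial_mean (card A) p g"
proof -
  have "measure_pmf.expectation (Pi_pmf A d (\<lambda>_. bernoulli_pmf p)) (\<lambda>f. g (card {x\<in>A. f x}))
      = measure_pmf.expectation (binomial_pmf (card A) p) g"
    using assms by (subst binomial_pmf_altdef'[where dflt = d and A = A]) auto
  also have "\<dots> = binomial_mean (card A) p g"
    using assms by (simp add: expectation_binomial_pmf' binomial_mean_def)
  finally show ?thesis .
qed

text \<open>Condition on the bets of players 1 and 2; the number of Heads among the other
  \<open>N - 2\<close> players is then binomial.\<close>

lemma expectation_bets_profile:
  fixes g :: "bool \<Rightarrow> bool \<Rightarrow> nat \<Rightarrow> real"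
  assumes "N \<ge> 3" "x \<in> {0..1}" "q \<in> {0..1}" "p \<in> {0..1}"
    and h: "\<And>a. h a = g (a 1) (a 2) (card {j\<in>{3..N}. a j})"
  shows "measure_pmf.expectation (bets N (profile x q p)) h
    = x * (q * binomial_mean (N - 2) p (g True True)
            + (1 - q) * binomial_mean (N - 2) p (g True False))
      + (1 - x) * (q * binomial_mean (N - 2) p (g False True)
            + (1 - q) * binomial_mean (N - 2) p (g False False))"
proof -
  have N: "{1..N} = insert 1 (insert 2 {3..N})" using assms(1) by auto
  have rest: "Pi_pmf {3..N} False (\<lambda>j. bernoulli_pmf (profile x q p j))
      = Pi_pmf {3..N} False (\<lambda>_. bernoulli_pmf p)"
    by (intro Pi_pmf_cong) (auto simp: profile_def)
  have "{j \<in> {3..N}. (f(2 := b, 1 := a)) j} = {j \<in> {3..N}. f j}" for a b and f :: "nat \<Rightarrow> bool"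
    by auto
  then have h': "h (f(2 := b, 1 := a)) = g a b (card {j\<in>{3..N}. f j})"
    for a b and f :: "nat \<Rightarrow> bool"
    unfolding h by simp
  have "measure_pmf.expectation (Pi_pmf {3..N} False (\<lambda>_. bernoulli_pmf p))
      (\<lambda>f. h (f(2 := b, 1 := a))) = binomial_mean (N - 2) p (g a b)" for a b
    unfolding h' using expectation_Pi_bernoulli_card[of "{3..N}" p False "g a b"] assms(1,4)
    by (simp add: numeral_3_eq_3 numeral_2_eq_2 Suc_diff_Suc)
  moreover have "profile x q p 1 = x" "profile x q p 2 = q" by (auto simp: profile_def)
  ultimately show ?thesis
    unfolding bets_def N using assms(2,3)
    by (simp only: expectation_Pi_bernoulli_insert finite_insert finite_atLeastAtMost rest
        insert_iff atLeastAtMost_iff) (simp add: expectation_Pi_bernoulli_insert rest)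
qed

text \<open>Puts the payoff in the form required by the preceding expectation formula. A wrong bet
  costs 1 unless everybody is wrong, which explains the \<open>of_bool\<close> term.\<close>

lemma payoff_eq_count:
  assumes "N \<ge> 3"
  shows "payoff N 1 a w =
    (if a 1 = w
     then real N / (1 + of_bool (a 2 = w) + real (card {j\<in>{3..N}. a j = w})) - 1
     else of_bool (a 2 \<noteq> w \<and> card {j\<in>{3..N}. a j = w} = 0) - 1)"
proof -
  have N: "{1..N} = insert 1 (insert 2 {3..N})" using assms by auto
  have "(\<Sum>j\<in>{3..N}. of_bool (a j = w)) = real (card {j\<in>{3..N}. a j = w})"
    by (simp add: sum_of_bool_eq Int_def)
  then have sum: "(\<Sum>j\<in>{1..N}. of_bool (a j = w))
      = of_bool (a 1 = w) + of_bool (a 2 = w) + real (card {j\<in>{3..N}. a j = w})"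
    unfolding N by (simp del: sum_of_bool_eq)
  have ex: "(\<exists>j\<in>{1..N}. a j = w)
      \<longleftrightarrow> a 1 = w \<or> a 2 = w \<or> card {j\<in>{3..N}. a j = w} \<noteq> 0"
    unfolding N by auto
  show ?thesis
    unfolding payoff_def sum ex by auto
qed

lemma card_Tails_eq:
  fixes a :: "nat \<Rightarrow> bool"
  shows "card {j\<in>{3..N}. a j = False} = N - 2 - card {j\<in>{3..N}. a j}"
proof -
  have "{j\<in>{3..N}. a j = False} = {3..N} - {j\<in>{3..N}. a j}" by auto
  also have "card \<dots> = card {3..N} - card {j\<in>{3..N}. a j}"
    by (rule card_Diff_subset) auto
  finally show ?thesis by simp
qed

lemma utility_eq:
  assumes "N \<ge> 3" "x \<in> {0..1}" "q \<in> {0..1}" "p \<in> {0..1}"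
  shows "utility N 1 (profile x q p) \<rho>
    = x * (coeff_A N \<rho> p * q + coeff_B N \<rho> p) + utility N 1 (profile 0 q p) \<rho>"
proof -
  let ?E = "\<lambda>x w. measure_pmf.expectation (bets N (profile x q p)) (\<lambda>a. payoff N 1 a w)"
  define m where "m = N - 2"
  \<comment> \<open>The probability that none of the other \<open>N - 2\<close> players bets on the
    outcome. It enters both bets of player 1 when player 2 is wrong, and cancels in the
    slope.\<close>
  define z where "z = (\<lambda>p. binomial_mean m p (\<lambda>k. of_bool (k = 0)))"
  have z: "lone_gain N p = real N * binomial_mean m p (\<lambda>k. 1 / (real k + 1)) - z p" for p
    by (simp add: z_def lone_gain_def m_def binomial_mean_at_0)
  have zero: "(0::real) \<in> {0..1}" by simp
  have True_gain: "?E x True = ?E 0 True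
      + x * (q * shared_gain N p + (1 - q) * lone_gain N p)" if x: "x \<in> {0..1}" for x
  proof -
    define g where "g = (\<lambda>a b k. if a then real N * (1 / (real k + (1 + of_bool b))) - 1
        else of_bool (\<not> b \<and> k = 0) - 1)"
    have "payoff N 1 a True = g (a 1) (a 2) (card {j\<in>{3..N}. a j})" for a
      using payoff_eq_count[OF assms(1), of a True] by (simp add: g_def add_ac)
    note E = expectation_bets_profile[where g = g and h = "\<lambda>a. payoff N 1 a True",
        OF assms(1) _ assms(3,4) this]
    have mean: "binomial_mean m p (g True True) = shared_gain N p - 1"
      "binomial_mean m p (g True False) = lone_gain N p + z p - 1"
      "binomial_mean m p (g False True) = - 1"
      "binomial_mean m p (g False False) = z p - 1"
      by (simp_all add: g_def[abs_def] binomial_mean_diff binomial_mean_cmult binomial_mean_const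
          z z_def shared_gain_def del: times_divide_eq_right flip: m_def)
    note E = E[folded m_def, unfolded mean]
    show ?thesis
      unfolding E[OF x] E[OF zero] by (simp add: algebra_simps)
  qed
  have False_gain: "?E x False = ?E 0 False
      - x * (q * lone_gain N (1 - p) + (1 - q) * shared_gain N (1 - p))" if x: "x \<in> {0..1}" for x
  proof -
    \<comment> \<open>The argument \<open>k\<close> still counts Heads, so \<open>m - k\<close>
      counts the winning Tails bets; reflection then replaces \<open>p\<close> by
      \<open>1 - p\<close>. Betting on Heads forgoes the gain here, hence the negative
      slope.\<close>
    define g where "g = (\<lambda>a b k. if a then of_bool (b \<and> m - k = 0) - 1
        else real N * (1 / (real (m - k) + (1 + of_bool (\<not> b)))) - 1)"
    have "payoff N 1 a False = g (a 1) (a 2) (card {j\<in>{3..N}. a j})" for a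
      unfolding payoff_eq_count[OF assms(1)] card_Tails_eq g_def m_def by (simp add: add_ac)
    note E = expectation_bets_profile[where g = g and h = "\<lambda>a. payoff N 1 a False",
        OF assms(1) _ assms(3,4) this]
    have reflect: "binomial_mean m p (\<lambda>k. f (m - k)) = binomial_mean m (1 - p) f" for f
      by (simp add: binomial_mean_reflect)
    have TT: "binomial_mean m p (g True True) = z (1 - p) - 1"
      using reflect[of "\<lambda>t. of_bool (t = 0) - 1"]
      by (simp add: g_def binomial_mean_diff binomial_mean_const z_def)
    have TF: "binomial_mean m p (g True False) = - 1"
      by (simp add: g_def binomial_mean_const)
    have FT: "binomial_mean m p (g False True) = lone_gain N (1 - p) + z (1 - p) - 1"
      using reflect[of "\<lambda>t. real N * (1 / (real t + 1)) - 1"]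
      by (simp add: g_def binomial_mean_diff binomial_mean_const binomial_mean_cmult z
          del: times_divide_eq_right)
    have FF: "binomial_mean m p (g False False) = shared_gain N (1 - p) - 1"
      using reflect[of "\<lambda>t. real N * (1 / (real t + 2)) - 1"]
      by (simp add: g_def binomial_mean_diff binomial_mean_const binomial_mean_cmult
          shared_gain_def del: times_divide_eq_right flip: m_def)
    note E = E[folded m_def, unfolded TT TF FT FF]
    show ?thesis
      unfolding E[OF x] E[OF zero] by (simp add: algebra_simps)
  qed
  have A: "coeff_A N \<rho> p = \<rho> * shared_gain N p - (1 - \<rho>) * lone_gain N (1 - p) - coeff_B N \<rho> p"
    using coeff_A_plus_coeff_B_eq[OF assms(1), of \<rho> p] by simp
  show ?thesis
    unfolding utility_def True_gain[OF assms(2)] False_gain[OF assms(2)] A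
      coeff_B_eq[OF assms(1)]
    by (simp add: algebra_simps)
qed

section \<open>Best responses and the sign of the slope\<close>

text \<open>Comparing a point with the two endpoints of the interval already decides whether it is a
  maximizer.\<close>

lemma is_arg_max_affine:
  fixes \<alpha> c :: real
  assumes "\<And>x. x \<in> {0..1} \<Longrightarrow> f x = x * \<alpha> + c"
  shows "{x. is_arg_max f (\<lambda>x. x \<in> {0..1}) x}
    = (if \<alpha> > 0 then {1} else if \<alpha> < 0 then {0} else {0..1})"
proof -
  have "is_arg_max f (\<lambda>x. x \<in> {0..1}) x
      \<longleftrightarrow> x \<in> {0..1} \<and> (\<forall>y\<in>{0..1}. y * \<alpha> \<le> x * \<alpha>)" for x
    using assms by (auto simp: is_arg_max_linorder)
  moreover have "(\<forall>y\<in>{0..1}. y * \<alpha> \<le> x * \<alpha>)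
      \<longleftrightarrow> (if \<alpha> > 0 then x = 1 else if \<alpha> < 0 then x = 0 else True)"
    if "x \<in> {0..1}" for x
  proof -
    consider "\<alpha> > 0" | "\<alpha> < 0" | "\<alpha> = 0" by linarith
    then show ?thesis
      using that by cases (auto dest: bspec[of _ _ 0] bspec[of _ _ 1])
  qed
  ultimately have *: "is_arg_max f (\<lambda>x. x \<in> {0..1}) x
      \<longleftrightarrow> x \<in> {0..1} \<and> (if \<alpha> > 0 then x = 1 else if \<alpha> < 0 then x = 0 else True)" for x
    by blast
  show ?thesis unfolding * by auto
qed

theorem mainTheorem4:
  fixes N :: nat and \<rho>\<^sub>1 \<rho>\<^sub>2 p q \<alpha> :: real
  assumes "N \<ge> 3"
    and "\<rho>\<^sub>1 \<in> {0..1}" and "\<rho>\<^sub>2 \<in> {0..1}" and "p \<in> {0..1}"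
    and q_eq: "q = max 0 (min 1 (- (coeff_B N \<rho>\<^sub>2 p / coeff_A N \<rho>\<^sub>2 p)))"
    and alpha_eq: "\<alpha> = coeff_A N \<rho>\<^sub>1 p * q + coeff_B N \<rho>\<^sub>1 p"
  shows "{x. is_arg_max (\<lambda>x. utility N 1 (profile x q p) \<rho>\<^sub>1) (\<lambda>x. x \<in> {0..1}) x}
           = (if \<alpha> > 0 then {1} else if \<alpha> < 0 then {0} else {0..1})
    \<and> (rho_up p N \<le> \<rho>\<^sub>2 \<longrightarrow>
          q = 1
          \<and> (\<alpha> > 0 \<longleftrightarrow> \<rho>\<^sub>1 > rho_up p N)
          \<and> (\<alpha> = 0 \<longleftrightarrow> \<rho>\<^sub>1 = rho_up p N)
          \<and> (\<alpha> < 0 \<longleftrightarrow> \<rho>\<^sub>1 < rho_up p N))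
    \<and> (\<rho>\<^sub>2 \<le> rho_down p N \<longrightarrow>
          q = 0
          \<and> (\<alpha> > 0 \<longleftrightarrow> \<rho>\<^sub>1 > rho_down p N)
          \<and> (\<alpha> = 0 \<longleftrightarrow> \<rho>\<^sub>1 = rho_down p N)
          \<and> (\<alpha> < 0 \<longleftrightarrow> \<rho>\<^sub>1 < rho_down p N))
    \<and> (rho_down p N < \<rho>\<^sub>2 \<and> \<rho>\<^sub>2 < rho_up p N \<longrightarrow>
          q = - (coeff_B N \<rho>\<^sub>2 p / coeff_A N \<rho>\<^sub>2 p) \<and> q \<in> {0<..<1}
          \<and> (\<alpha> > 0 \<longleftrightarrow> \<rho>\<^sub>1 > \<rho>\<^sub>2)
          \<and> (\<alpha> = 0 \<longleftrightarrow> \<rho>\<^sub>1 = \<rho>\<^sub>2)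
          \<and> (\<alpha> < 0 \<longleftrightarrow> \<rho>\<^sub>1 < \<rho>\<^sub>2))"
proof -
  define G0 G1 H0 H1 where "G0 = lone_gain N p" and "G1 = shared_gain N p"
    and "H0 = shared_gain N (1 - p)" and "H1 = lone_gain N (1 - p)"
  have pos: "0 < G1" "G1 < G0" "0 < H0" "H0 < H1"
    using assms by (auto simp: G0_def G1_def H0_def H1_def
        intro!: shared_gain_pos shared_gain_less_lone_gain)
  define A B where "A = coeff_A N \<rho>\<^sub>2 p" and "B = coeff_B N \<rho>\<^sub>2 p"
  have B: "coeff_B N \<rho> p = \<rho> * (G0 + H0) - H0" for \<rho>
    using coeff_B_eq[OF assms(1)] by (simp add: G0_def H0_def algebra_simps)
  have AB: "coeff_A N \<rho> p + coeff_B N \<rho> p = \<rho> * (G1 + H1) - H1" for \<rho>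
    using coeff_A_plus_coeff_B_eq[OF assms(1)] by (simp add: G1_def H1_def algebra_simps)
  have B2: "B = \<rho>\<^sub>2 * (G0 + H0) - H0" and AB2: "A + B = \<rho>\<^sub>2 * (G1 + H1) - H1"
    using B AB by (simp_all add: A_def B_def)
  have "A = - (\<rho>\<^sub>2 * (G0 - G1) + (1 - \<rho>\<^sub>2) * (H1 - H0))"
    using B2 AB2 by (simp add: algebra_simps)
  \<comment> \<open>The first summand is positive unless \<open>\<rho>\<^sub>2 = 0\<close>, and in
    that case the second one is.\<close>
  moreover have "0 < \<rho>\<^sub>2 * (G0 - G1) + (1 - \<rho>\<^sub>2) * (H1 - H0)"
    using pos assms(3) by (cases "\<rho>\<^sub>2 = 0") (auto intro!: add_pos_nonneg)
  ultimately have A: "A < 0" by simp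
  have q: "q = max 0 (min 1 (- (B / A)))" using q_eq by (simp add: A_def B_def)
  have \<alpha>: "\<alpha> = q * (\<rho>\<^sub>1 * (G1 + H1) - H1) + (1 - q) * (\<rho>\<^sub>1 * (G0 + H0) - H0)"
    unfolding alpha_eq AB[symmetric] B[symmetric] by (simp add: algebra_simps)
  have down: "rho_down p N = H0 / (G0 + H0)" and up: "rho_up p N = H1 / (G1 + H1)"
    using rho_down_eq[OF assms(1)] rho_up_eq[OF assms(1,4)]
    by (simp_all add: G0_def G1_def H0_def H1_def)
  have "q \<in> {0..1}" using q by auto
  then have "utility N 1 (profile x q p) \<rho>\<^sub>1 = x * \<alpha> + utility N 1 (profile 0 q p) \<rho>\<^sub>1"
    if "x \<in> {0..1}" for x
    using utility_eq[OF assms(1) that _ assms(4)] unfolding alpha_eq by blast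
  then have best_response: "{x. is_arg_max (\<lambda>x. utility N 1 (profile x q p) \<rho>\<^sub>1) (\<lambda>x. x \<in> {0..1}) x}
      = (if \<alpha> > 0 then {1} else if \<alpha> < 0 then {0} else {0..1})"
    by (rule is_arg_max_affine)
  \<comment> \<open>The trichotomy common to the three cases. Each case then only has to write
    \<alpha> as a positive multiple of \<open>\<rho>\<^sub>1 - r\<close>.\<close>
  define same_sign where "same_sign r \<longleftrightarrow>
    (\<alpha> > 0 \<longleftrightarrow> \<rho>\<^sub>1 > r) \<and> (\<alpha> = 0 \<longleftrightarrow> \<rho>\<^sub>1 = r) \<and> (\<alpha> < 0 \<longleftrightarrow> \<rho>\<^sub>1 < r)" for r
  have same_signI: "same_sign r" if "\<alpha> = d * (\<rho>\<^sub>1 - r)" "d > 0" for d r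
    using that unfolding same_sign_def by (simp add: zero_less_mult_iff mult_less_0_iff)
  have a: "q = 1 \<and> same_sign (rho_up p N)" if "rho_up p N \<le> \<rho>\<^sub>2"
  proof -
    \<comment> \<open>Above the upper threshold \<open>A + B\<close> is nonnegative; dividing by the
      negative \<open>A\<close> gives \<open>- (B / A) \<ge> 1\<close>, so the clipping yields
      1.\<close>
    have "A + B \<ge> 0" using that pos unfolding AB2 up by (simp add: field_simps)
    then have "- (B / A) \<ge> 1" using A by (simp add: field_simps)
    then have "q = 1" using q by simp
    moreover from this have "\<alpha> = (G1 + H1) * (\<rho>\<^sub>1 - rho_up p N)"
      using pos unfolding \<alpha> up by (simp add: field_simps)
    ultimately show ?thesis using pos by (intro conjI same_signI[where d = "G1 + H1"]) auto
  qed
  have b: "q = 0 \<and> same_sign (rho_down p N)" if "\<rho>\<^sub>2 \<le> rho_down p N"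
  proof -
    have "B \<le> 0" using that pos unfolding B2 down by (simp add: field_simps)
    then have "- (B / A) \<le> 0" using A by (simp add: divide_nonpos_neg)
    then have "q = 0" using q by simp
    moreover from this have "\<alpha> = (G0 + H0) * (\<rho>\<^sub>1 - rho_down p N)"
      using pos unfolding \<alpha> down by (simp add: field_simps)
    ultimately show ?thesis using pos by (intro conjI same_signI[where d = "G0 + H0"]) auto
  qed
  have c: "q = - (B / A) \<and> q \<in> {0<..<1} \<and> same_sign \<rho>\<^sub>2"
    if "rho_down p N < \<rho>\<^sub>2" "\<rho>\<^sub>2 < rho_up p N"
  proof -
    have "B > 0" using that(1) pos unfolding B2 down by (simp add: field_simps)
    moreover have "A + B < 0" using that(2) pos unfolding AB2 up by (simp add: field_simps)
    ultimately have "0 < - (B / A)" "- (B / A) < 1" using A by (simp_all add: field_simps)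
    then have q': "q = - (B / A)" "0 < q" "q < 1" using q by simp_all
    \<comment> \<open>An unclipped \<open>q\<close> makes the slope vanish at belief
      \<open>\<rho>\<^sub>2\<close>. Subtracting this zero from \<alpha> cancels the constant terms
      and leaves a multiple of \<open>\<rho>\<^sub>1 - \<rho>\<^sub>2\<close>.\<close>
    then have "q * (A + B) + (1 - q) * B = 0" using A by (simp add: field_simps)
    then have "q * (\<rho>\<^sub>2 * (G1 + H1) - H1) + (1 - q) * (\<rho>\<^sub>2 * (G0 + H0) - H0) = 0"
      by (simp only: AB2) (simp only: B2)
    then have "\<alpha> = (q * (G1 + H1) + (1 - q) * (G0 + H0)) * (\<rho>\<^sub>1 - \<rho>\<^sub>2)"
      unfolding \<alpha> by algebra
    moreover have "q * (G1 + H1) + (1 - q) * (G0 + H0) > 0"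
      using q' pos by (intro add_pos_pos mult_pos_pos) auto
    ultimately have "same_sign \<rho>\<^sub>2" by (rule same_signI)
    then show ?thesis using q' by simp
  qed
  show ?thesis
    using best_response a b c unfolding same_sign_def A_def B_def by blast
qed

end
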